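(* Let $V$ be a real vector space of dimension $d>1$, $\Gamma<\mathrm{SL}(V)$ a torsion-free projective Anosov subgroup with limit maps $\xi,\xi^*$, and $\widetilde{\mathcal{M}}_\Gamma$ as in the context. Let $[v:\alpha]\in\widetilde{\mathcal{M}}_\Gamma$ and $\gamma\in\Gamma\setminus\{e\}$ be such that $\gamma\cdot[v:\alpha]=[e^Tv:e^{-T}\alpha]$ for some $T\ge0$. Then $[v]=\xi(\gamma_+)$, $[\alpha]=\xi^*(\gamma_-)$ and $T=\lambda_1(\gamma)$.
   Context: Projective Anosov: finitely generated Gromov hyperbolic, $\lambda_1(\gamma)-\lambda_2(\gamma)\ge c|\gamma|_\infty-c'$, where $\lambda_1\ge\lambda_2\ge\dots$ are the logarithms of the moduli of eigenvalues and $|\cdot|_\infty$ is stable word length. Limit maps $\xi:\partial_\infty\Gamma\to\mathbb{P}(V)$, $\xi^*:\partial_\infty\Gamma\to\mathbb{P}(V^* )$: equivariant, $\xi(x)\subset\ker\xi^*(y)$ iff $x=y$, and for infinite order $\gamma$ with attracting/repelling boundary fixed points $\gamma_\pm=\lim_{n\to\pm\infty}\gamma^n$, $\lambda_1(\gamma)>0$, the eigenvalue of modulus $e^{\lambda_1(\gamma)}$ is real and simple with eigenline $\xi(\gamma_+)$, and the eigenline of the dual action $\alpha\mapsto\alpha\circ\gamma^{-1}$ for the eigenvalue of modulus $e^{-\lambda_1(\gamma)}$ is $\xi^*(\gamma_-)$. $\mathbb{L}=\{[v:\alpha]\in\mathbb{P}(V\times V^* ):\alpha(v)>0\}$, $\gamma\cdot[v:\alpha]=[\gamma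 v:\alpha\circ\gamma^{-1}]$, and $\widetilde{\mathcal{M}}_\Gamma=\{[v:\alpha]\in\mathbb{L}:\forall x\in\partial_\infty\Gamma,\ \xi^*(x)(v)\ne0\text{ or }\alpha(\xi(x))\ne0\}$ (where $\xi^*(x)(v)\neq 0$ means a representative linear form does not vanish on $v$). *)

theory Defs
  imports "HOL-Analysis.Analysis" "HOL-Computational_Algebra.Polynomial" "HOL-Library.Multiset"
begin

text \<open>V = real^'n (d = CARD('n)); endomorphisms are matrices real^'n^'n.
  A linear form alpha in V* is represented by a vector, alpha(w) = alpha \<bullet> w;
  the form alpha o g is then  alpha v* g  (row vector times matrix).
  Points of projective spaces are represented by nonzero representatives.\<close>

definition proj_eq :: "real^'n \<Rightarrow> real^'n \<Rightarrow> bool" where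
  "proj_eq u w \<longleftrightarrow> (\<exists>c. c \<noteq> 0 \<and> u = c *\<^sub>R w)"

definition mpow :: "real^'n^'n \<Rightarrow> nat \<Rightarrow> real^'n^'n" where
  "mpow g k = ((\<lambda>A. g ** A) ^^ k) (mat 1)"

subsection \<open>Eigenvalues\<close>

definition cpoly :: "real^'n^'n \<Rightarrow> complex poly" where
  "cpoly A = det (\<chi> i j. (if i = j then [:0, 1:] else 0) - [: complex_of_real (A $ i $ j) :])"

text \<open>Moduli of the complex eigenvalues, with multiplicity, in decreasing order.\<close>
definition eig_moduli :: "real^'n^'n \<Rightarrow> real list" where
  "eig_moduli A = rev (sorted_list_of_multiset (image_mset cmod (proots (cpoly A))))"

text \<open>lam k A = lambda_k(A), for k = 1, ..., d.\<close>
definition lam :: "nat \<Rightarrow> real^'n^'n \<Rightarrow> real" where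
  "lam k A = ln (eig_moduli A ! (k - 1))"

subsection \<open>Groups\<close>

definition SL_subgroup :: "(real^'n^'n) set \<Rightarrow> bool" where
  "SL_subgroup G \<longleftrightarrow> G \<subseteq> {A. det A = 1} \<and> mat 1 \<in> G
     \<and> (\<forall>g\<in>G. \<forall>h\<in>G. g ** h \<in> G) \<and> (\<forall>g\<in>G. matrix_inv g \<in> G)"

definition infinite_order :: "real^'n^'n \<Rightarrow> bool" where
  "infinite_order g \<longleftrightarrow> (\<forall>k>0. mpow g k \<noteq> mat 1)"

definition torsion_free :: "(real^'n^'n) set \<Rightarrow> bool" where
  "torsion_free G \<longleftrightarrow> (\<forall>g\<in>G. g \<noteq> mat 1 \<longrightarrow> infinite_order g)"

text \<open>Words in the generators S and their inverses.\<close>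
definition is_word :: "(real^'n^'n) set \<Rightarrow> (real^'n^'n) list \<Rightarrow> real^'n^'n \<Rightarrow> bool" where
  "is_word S ws g \<longleftrightarrow> set ws \<subseteq> S \<union> matrix_inv ` S \<and> foldr (**) ws (mat 1) = g"

definition generates :: "(real^'n^'n) set \<Rightarrow> (real^'n^'n) set \<Rightarrow> bool" where
  "generates S G \<longleftrightarrow> S \<subseteq> G \<and> (\<forall>g\<in>G. \<exists>ws. is_word S ws g)"

definition wlen :: "(real^'n^'n) set \<Rightarrow> real^'n^'n \<Rightarrow> nat" where
  "wlen S g = (LEAST k. \<exists>ws. length ws = k \<and> is_word S ws g)"

definition wdist :: "(real^'n^'n) set \<Rightarrow> real^'n^'n \<Rightarrow> real^'n^'n \<Rightarrow> real" where
  "wdist S g h = real (wlen S (matrix_inv g ** h))"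

text \<open>Gromov product (x|y)_w for the word metric.\<close>
definition gprod :: "(real^'n^'n) set \<Rightarrow> real^'n^'n \<Rightarrow> real^'n^'n \<Rightarrow> real^'n^'n \<Rightarrow> real" where
  "gprod S w x y = (wdist S x w + wdist S y w - wdist S x y) / 2"

definition gromov_hyperbolic :: "(real^'n^'n) set \<Rightarrow> (real^'n^'n) set \<Rightarrow> bool" where
  "gromov_hyperbolic G S \<longleftrightarrow> (\<exists>\<delta>\<ge>0. \<forall>x\<in>G. \<forall>y\<in>G. \<forall>z\<in>G. \<forall>w\<in>G.
      gprod S w x z \<ge> min (gprod S w x y) (gprod S w y z) - \<delta>)"

text \<open>Finitely generated hyperbolic group, with a chosen finite generating set S.\<close>
definition fg_hyperbolic :: "(real^'n^'n) set \<Rightarrow> (real^'n^'n) set \<Rightarrow> bool" where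
  "fg_hyperbolic G S \<longleftrightarrow> finite S \<and> generates S G \<and> gromov_hyperbolic G S"

subsection \<open>Gromov boundary (sequences converging at infinity, modulo equivalence)\<close>

definition conv_inf :: "(real^'n^'n) set \<Rightarrow> (real^'n^'n) set \<Rightarrow> (nat \<Rightarrow> real^'n^'n) \<Rightarrow> bool" where
  "conv_inf G S s \<longleftrightarrow> (\<forall>k. s k \<in> G) \<and>
     (\<forall>K. \<exists>N. \<forall>m\<ge>N. \<forall>k\<ge>N. gprod S (mat 1) (s m) (s k) \<ge> K)"

definition seq_equiv :: "(real^'n^'n) set \<Rightarrow> (nat \<Rightarrow> real^'n^'n) \<Rightarrow> (nat \<Rightarrow> real^'n^'n) \<Rightarrow> bool" where
  "seq_equiv S s t \<longleftrightarrow> (\<forall>K. \<exists>N. \<forall>m\<ge>N. \<forall>k\<ge>N. gprod S (mat 1) (s m) (t k) \<ge> K)"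

definition bclass :: "(real^'n^'n) set \<Rightarrow> (real^'n^'n) set \<Rightarrow> (nat \<Rightarrow> real^'n^'n) \<Rightarrow> (nat \<Rightarrow> real^'n^'n) set" where
  "bclass G S s = {t. conv_inf G S t \<and> seq_equiv S s t}"

definition bdry :: "(real^'n^'n) set \<Rightarrow> (real^'n^'n) set \<Rightarrow> (nat \<Rightarrow> real^'n^'n) set set" where
  "bdry G S = {bclass G S s | s. conv_inf G S s}"

text \<open>Action of g on the boundary (left translation of sequences).\<close>
definition bact :: "real^'n^'n \<Rightarrow> (nat \<Rightarrow> real^'n^'n) set \<Rightarrow> (nat \<Rightarrow> real^'n^'n) set" where
  "bact g x = (\<lambda>t k. g ** t k) ` x"

text \<open>gamma_+ = lim gamma^n, gamma_- = lim gamma^(-n).\<close>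
definition attr_pt :: "(real^'n^'n) set \<Rightarrow> (real^'n^'n) set \<Rightarrow> real^'n^'n \<Rightarrow> (nat \<Rightarrow> real^'n^'n) set" where
  "attr_pt G S g = bclass G S (\<lambda>k. mpow g k)"

definition rep_pt :: "(real^'n^'n) set \<Rightarrow> (real^'n^'n) set \<Rightarrow> real^'n^'n \<Rightarrow> (nat \<Rightarrow> real^'n^'n) set" where
  "rep_pt G S g = bclass G S (\<lambda>k. mpow (matrix_inv g) k)"

subsection \<open>Projective Anosov\<close>

definition stable_len :: "(real^'n^'n) set \<Rightarrow> real^'n^'n \<Rightarrow> real" where
  "stable_len S g = lim (\<lambda>k. real (wlen S (mpow g k)) / real k)"

definition proj_anosov :: "(real^'n^'n) set \<Rightarrow> (real^'n^'n) set \<Rightarrow> bool" where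
  "proj_anosov G S \<longleftrightarrow> SL_subgroup G \<and> fg_hyperbolic G S \<and>
     (\<exists>c>0. \<exists>c'. \<forall>g\<in>G. lam 1 g - lam 2 g \<ge> c * stable_len S g - c')"

text \<open>Limit maps xi : bdry -> P(V), xis : bdry -> P(V*), given by nonzero representatives.\<close>
definition limit_maps :: "(real^'n^'n) set \<Rightarrow> (real^'n^'n) set
    \<Rightarrow> ((nat \<Rightarrow> real^'n^'n) set \<Rightarrow> real^'n) \<Rightarrow> ((nat \<Rightarrow> real^'n^'n) set \<Rightarrow> real^'n) \<Rightarrow> bool" where
  "limit_maps G S \<xi> \<xi>s \<longleftrightarrow>
     (\<forall>x\<in>bdry G S. \<xi> x \<noteq> 0 \<and> \<xi>s x \<noteq> 0) \<and>
     (\<forall>g\<in>G. \<forall>x\<in>bdry G S. proj_eq (\<xi> (bact g x)) (g *v \<xi> x)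
                          \<and> proj_eq (\<xi>s (bact g x)) (\<xi>s x v* matrix_inv g)) \<and>
     (\<forall>x\<in>bdry G S. \<forall>y\<in>bdry G S. \<xi>s y \<bullet> \<xi> x = 0 \<longleftrightarrow> x = y) \<and>
     (\<forall>g\<in>G. infinite_order g \<longrightarrow>
        lam 1 g > 0 \<and>
        (\<exists>\<mu>::real. \<bar>\<mu>\<bar> = exp (lam 1 g)
            \<and> count (proots (cpoly g)) (complex_of_real \<mu>) = 1
            \<and> (\<forall>z. z \<in># proots (cpoly g) \<and> cmod z = exp (lam 1 g) \<longrightarrow> z = complex_of_real \<mu>)
            \<and> {w. g *v w = \<mu> *\<^sub>R w} = span {\<xi> (attr_pt G S g)}) \<and>
        (\<exists>\<nu>::real. \<bar>\<nu>\<bar> = exp (- lam 1 g)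
            \<and> {a. a v* matrix_inv g = \<nu> *\<^sub>R a} = span {\<xi>s (rep_pt G S g)}))"

text \<open>The domain M~_Gamma inside L.\<close>
definition Mtilde :: "(real^'n^'n) set \<Rightarrow> (real^'n^'n) set
    \<Rightarrow> ((nat \<Rightarrow> real^'n^'n) set \<Rightarrow> real^'n) \<Rightarrow> ((nat \<Rightarrow> real^'n^'n) set \<Rightarrow> real^'n)
    \<Rightarrow> real^'n \<Rightarrow> real^'n \<Rightarrow> bool" where
  "Mtilde G S \<xi> \<xi>s v \<alpha> \<longleftrightarrow> \<alpha> \<bullet> v > 0 \<and>
     (\<forall>x\<in>bdry G S. \<xi>s x \<bullet> v \<noteq> 0 \<or> \<alpha> \<bullet> \<xi> x \<noteq> 0)"

text \<open>g . [v:alpha] = [u:beta] in P(V x V*).\<close>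
definition act_eq :: "real^'n^'n \<Rightarrow> real^'n \<Rightarrow> real^'n \<Rightarrow> real^'n \<Rightarrow> real^'n \<Rightarrow> bool" where
  "act_eq g v \<alpha> u \<beta> \<longleftrightarrow> (\<exists>c::real. c \<noteq> 0 \<and> g *v v = c *\<^sub>R u \<and> \<alpha> v* matrix_inv g = c *\<^sub>R \<beta>)"

end

theory Submission
  imports Defs "HOL-Real_Asymp.Real_Asymp"
begin

(* The pairing alpha(v) > 0 is invariant under gamma, so the scalar in
   gamma.[v:alpha] = [e^T v : e^-T alpha] is +-1: v is an eigenvector of gamma with eigenvalue
   +-e^T and alpha an eigenvector of the dual action with eigenvalue +-e^-T.  The repelling point
   gamma_- is the attracting point of gamma^-1, so xi(gamma_-) is an eigenvector of gamma^-1 with an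
   eigenvalue of modulus > 1 >= e^-T; pairing it with alpha forces alpha(xi(gamma_-)) = 0, hence
   xi*(gamma_-)(v) <> 0 because [v:alpha] lies in M~.  Pairing xi*(gamma_-) with v now gives
   e^-lambda_1(gamma) = e^-T, and the simplicity of the extreme eigenvalues puts alpha on the line
   xi*(gamma_-) and v on the line xi(gamma_+).

   That gamma_- is a point of the Gromov boundary at all needs hyperbolicity: an eigenvalue of
   modulus > 1 makes |gamma^n| grow linearly, so for some N the step |gamma^2N| - |gamma^N| exceeds
   4 delta; the progression gamma^qN is then a local quasi-geodesic, and the four-point condition
   propagates the local bound on Gromov products to a global one, so (gamma^m | gamma^k)_1 -> oo. *)

section \<open>Matrix inverses and eigenvectors\<close>

lemma matrix_inv_inverse:
  fixes A :: "'a::semiring_1^'n^'m"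
  assumes "invertible A"
  shows matrix_inv_right: "A ** matrix_inv A = mat 1"
    and matrix_inv_left: "matrix_inv A ** A = mat 1"
proof -
  have "\<exists>A'. A ** A' = mat 1 \<and> A' ** A = mat 1"
    using assms unfolding invertible_def .
  then have "A ** matrix_inv A = mat 1 \<and> matrix_inv A ** A = mat 1"
    unfolding matrix_inv_def by (rule someI_ex)
  then show "A ** matrix_inv A = mat 1" "matrix_inv A ** A = mat 1" by auto
qed

lemma matrix_inv_unique:
  fixes A :: "'a::semiring_1^'n^'m"
  assumes "invertible A" "B ** A = mat 1"
  shows "matrix_inv A = B"
proof -
  have "B = B ** (A ** matrix_inv A)" by (simp add: matrix_inv_right[OF assms(1)])
  also have "\<dots> = matrix_inv A" by (simp add: matrix_mul_assoc assms(2))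
  finally show ?thesis by simp
qed

lemma invertible_matrix_inv:
  fixes A :: "'a::semiring_1^'n^'m"
  assumes "invertible A"
  shows "invertible (matrix_inv A)"
  unfolding invertible_def using matrix_inv_inverse[OF assms] by blast

lemma matrix_inv_matrix_inv:
  fixes A :: "'a::semiring_1^'n^'m"
  assumes "invertible A"
  shows "matrix_inv (matrix_inv A) = A"
  by (rule matrix_inv_unique[OF invertible_matrix_inv[OF assms] matrix_inv_right[OF assms]])

lemma matrix_inv_mult:
  fixes A B :: "'a::semiring_1^'n^'n"
  assumes "invertible A" "invertible B"
  shows "matrix_inv (A ** B) = matrix_inv B ** matrix_inv A"
proof (rule matrix_inv_unique)
  show "invertible (A ** B)" using assms by (rule invertible_mult)
  have "matrix_inv B ** matrix_inv A ** (A ** B) = matrix_inv B ** (matrix_inv A ** A) ** B"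
    by (simp add: matrix_mul_assoc)
  then show "matrix_inv B ** matrix_inv A ** (A ** B) = mat 1"
    by (simp add: matrix_inv_left assms)
qed

lemma matrix_inv_mat_1: "matrix_inv (mat 1 :: 'a::semiring_1^'n^'n) = mat 1"
  by (rule matrix_inv_unique) (auto simp: invertible_def)

lemma matrix_inv_eigenvector:
  fixes g :: "real^'n^'n"
  assumes "invertible g" "g *v v = c *\<^sub>R v"
  shows "matrix_inv g *v v = inverse c *\<^sub>R v"
proof -
  have "v = matrix_inv g *v (g *v v)"
    by (simp add: matrix_vector_mul_assoc matrix_inv_left[OF assms(1)])
  then have v: "v = c *\<^sub>R (matrix_inv g *v v)"
    by (simp add: assms(2) matrix_vector_mult_scaleR)
  show ?thesis
  proof (cases "c = 0")
    case False
    then show ?thesis by (subst (2) v) simp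
  qed (use v in simp)
qed

lemma eigenvector_pairing:
  fixes g :: "real^'n^'n"
  assumes "a v* g = \<nu> *\<^sub>R a" "g *v w = \<mu> *\<^sub>R w" "a \<bullet> w \<noteq> 0"
  shows "\<nu> = \<mu>"
proof -
  have "\<nu> * (a \<bullet> w) = \<mu> * (a \<bullet> w)"
    using dot_lmul_matrix[of a g w] by (simp add: assms(1,2))
  then show ?thesis using assms(3) by simp
qed

section \<open>Powers and the characteristic polynomial\<close>

lemma mpow_0 [simp]: "mpow g 0 = mat 1"
  by (simp add: mpow_def)

lemma mpow_Suc: "mpow g (Suc k) = g ** mpow g k"
  by (simp add: mpow_def)

lemma mpow_add: "mpow g (m + n) = mpow g m ** mpow g n"
  by (induction m) (auto simp: mpow_Suc matrix_mul_assoc)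

lemma mpow_eigenvector: "g *v w = \<mu> *\<^sub>R w \<Longrightarrow> mpow g n *v w = (\<mu> ^ n) *\<^sub>R w"
  by (induction n)
    (auto simp: mpow_Suc matrix_vector_mul_assoc[symmetric] matrix_vector_mult_scaleR)

lemma poly_cpoly_of_real:
  fixes A :: "real^'n^'n"
  shows "poly (cpoly A) (complex_of_real x) = complex_of_real (det (mat x - A))"
  unfolding cpoly_def det_def poly_sum of_real_sum of_real_prod
  by (simp add: poly_prod, intro sum.cong refl arg_cong2[where f="(*)"] prod.cong)
    (auto simp: mat_def)

lemma mat_mult_vector: "(mat x :: real^'n^'n) *v w = x *\<^sub>R w"
proof -
  have "(\<Sum>j\<in>UNIV. (if i = j then x else 0) * w $ j) = (\<Sum>j\<in>UNIV. if i = j then x * w $ j else 0)"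
    for i by (rule sum.cong) auto
  then show ?thesis by (simp add: vec_eq_iff matrix_vector_mult_def mat_def)
qed

lemma cpoly_real_root_iff_eigenvector:
  fixes A :: "real^'n^'n"
  shows "poly (cpoly A) (complex_of_real x) = 0 \<longleftrightarrow> (\<exists>w. w \<noteq> 0 \<and> A *v w = x *\<^sub>R w)"
proof -
  have "poly (cpoly A) (complex_of_real x) = 0 \<longleftrightarrow> \<not> invertible (mat x - A)"
    by (simp add: poly_cpoly_of_real invertible_det_nz)
  also have "\<dots> \<longleftrightarrow> \<not> (\<exists>B. B ** (mat x - A) = mat 1)"
    by (simp add: invertible_left_inverse)
  also have "\<dots> \<longleftrightarrow> (\<exists>w. w \<noteq> 0 \<and> (mat x - A) *v w = 0)"
    using matrix_left_invertible_ker by blast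
  also have "\<dots> \<longleftrightarrow> (\<exists>w. w \<noteq> 0 \<and> A *v w = x *\<^sub>R w)"
    by (simp add: matrix_vector_mult_diff_rdistrib mat_mult_vector) (metis right_minus_eq)
  finally show ?thesis .
qed

section \<open>Gromov products along progressions\<close>

lemma gromov_product_chain_bound:
  fixes D :: "nat \<Rightarrow> nat \<Rightarrow> real" and \<delta> A L :: real
  defines "gp \<equiv> \<lambda>w x y. (D x w + D y w - D x y) / 2"
  assumes sym: "\<And>x y. D x y = D y x" and refl: "\<And>x. D x x = 0"
    and hyp: "\<And>w x y z. gp w x z \<ge> min (gp w x y) (gp w y z) - \<delta>"
    and step: "\<And>m. D m (m + 1) \<ge> L" and mid: "\<And>m. m \<ge> 1 \<Longrightarrow> gp m (m - 1) (m + 1) \<le> A"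
    and long: "L > 2 * A + 4 * \<delta>" and "0 \<le> A" and "0 \<le> \<delta>"
  shows "i \<le> m \<Longrightarrow> m \<le> j \<Longrightarrow> gp m i j \<le> A + 2 * \<delta>"
proof (induction "j - i" arbitrary: i m j rule: less_induct)
  case less
  show ?case
  proof (cases "i = m \<or> m = j")
    case True
    then show ?thesis using \<open>0 \<le> A\<close> \<open>0 \<le> \<delta>\<close> sym refl unfolding gp_def by auto
  next
    case False
    \<comment> \<open>If \<open>(i|j)_m\<close> were large, the four-point condition at \<open>m\<close> would make \<open>(m-1|m+1)_m\<close>
      large too, through \<open>(m-1|i)_m\<close> and \<open>(j|m+1)_m\<close>: these are large because the steps are long
      while \<open>(i|m)_(m-1)\<close> and \<open>(m|j)_(m+1)\<close> are small by induction.\<close>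
    then have "i < m" "m < j" using less.prems by auto
    have left: "gp m (m - 1) i = D (m - 1) m - gp (m - 1) i m"
      and right: "gp m j (m + 1) = D m (m + 1) - gp (m + 1) m j"
      unfolding gp_def using sym by (simp_all add: field_simps)
    have "gp (m - 1) i m \<le> A + 2 * \<delta>" and "gp (m + 1) m j \<le> A + 2 * \<delta>"
      using less.hyps \<open>i < m\<close> \<open>m < j\<close> by auto
    moreover have "D (m - 1) m \<ge> L" using step[of "m - 1"] \<open>i < m\<close> by simp
    moreover have "gp m (m - 1) (m + 1) \<ge> min (gp m (m - 1) i) (gp m i (m + 1)) - \<delta>"
      and "gp m i (m + 1) \<ge> min (gp m i j) (gp m j (m + 1)) - \<delta>"
      by (rule hyp)+
    moreover have "gp m (m - 1) (m + 1) \<le> A" using mid \<open>i < m\<close> by simp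
    ultimately show ?thesis
      using left right step[of m] long \<open>0 \<le> \<delta>\<close> unfolding min_def by (auto split: if_splits)
  qed
qed

lemma gromov_product_progression_bound:
  fixes D :: "nat \<Rightarrow> nat \<Rightarrow> real" and h :: "nat \<Rightarrow> real" and \<delta> :: real
  defines "gp \<equiv> \<lambda>w x y. (D x w + D y w - D x y) / 2"
  assumes sym: "\<And>x y. D x y = D y x" and dist: "\<And>i j. i \<le> j \<Longrightarrow> D i j = h (j - i)"
    and hyp: "\<And>w x y z. gp w x z \<ge> min (gp w x y) (gp w y z) - \<delta>"
    and "h 0 = 0" and "0 \<le> \<delta>" and gap: "h 2 - h 1 > 4 * \<delta>" and "h 2 \<le> 2 * h 1"
  shows "gp 0 q q' \<ge> h (min q q') - (2 * h 1 - h 2) / 2 - 2 * \<delta>"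
proof -
  define A where "A = (2 * h 1 - h 2) / 2"
  have refl: "D x x = 0" for x
    using dist[of x x] \<open>h 0 = 0\<close> by simp
  have step: "h 1 \<le> D m (m + 1)" for m
    using dist[of m "m + 1"] by simp
  have mid: "gp m (m - 1) (m + 1) \<le> A" if "m \<ge> 1" for m
    using that dist[of "m - 1" m] dist[of m "m + 1"] dist[of "m - 1" "m + 1"] sym[of "m + 1" m]
    unfolding gp_def A_def by (simp add: numeral_2_eq_2 Suc_diff_le)
  have "h 1 > 2 * A + 4 * \<delta>" "0 \<le> A"
    using gap \<open>h 2 \<le> 2 * h 1\<close> unfolding A_def by (simp_all add: field_simps)
  then have chain: "gp m i j \<le> A + 2 * \<delta>" if "i \<le> m" "m \<le> j" for i m j
    using gromov_product_chain_bound[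
        OF sym refl hyp[unfolded gp_def] step mid[unfolded gp_def] _ _ \<open>0 \<le> \<delta>\<close> that]
    unfolding gp_def by simp
  have low: "gp 0 q q' \<ge> h q - A - 2 * \<delta>" if "q \<le> q'" for q q'
  proof -
    have "gp 0 q q' = D 0 q - gp q 0 q'"
      unfolding gp_def using sym[of 0 q] sym[of q' q] sym[of 0 q'] by (simp add: field_simps)
    with chain[of 0 q q'] dist[of 0 q] that show ?thesis by simp
  qed
  have "gp 0 q q' = gp 0 q' q" unfolding gp_def using sym[of q q'] by simp
  then show ?thesis
    using low[of q q'] low[of q' q] unfolding A_def by (cases "q \<le> q'") (simp_all add: min_def)
qed

lemma linear_growth_doubling_gap:
  fixes f :: "nat \<Rightarrow> real"
  assumes "a > 0" and growth: "\<And>n. a * real n \<le> f n"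
  shows "\<exists>N\<ge>1. f (2 * N) - f N > C"
proof (rule ccontr)
  assume "\<not> ?thesis"
  then have doubling: "f (2 * N) \<le> f N + C" if "N \<ge> 1" for N
    using that by force
  have iterate: "f (2 ^ k) \<le> f 1 + C * real k" for k
  proof (induction k)
    case (Suc k)
    have "f (2 ^ Suc k) \<le> f (2 ^ k) + C" using doubling[of "2 ^ k"] by simp
    with Suc show ?case by (simp add: algebra_simps)
  qed simp
  have "eventually (\<lambda>k. f 1 + C * real k < a * 2 ^ k) sequentially"
    using \<open>a > 0\<close> by real_asymp
  then obtain k where "f 1 + C * real k < a * 2 ^ k"
    by (auto simp: eventually_sequentially)
  with iterate[of k] growth[of "2 ^ k"] show False by simp
qed

section \<open>Word length and the word metric\<close>

lemma SL_subgroup_invertible: "SL_subgroup G \<Longrightarrow> g \<in> G \<Longrightarrow> invertible g"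
  unfolding SL_subgroup_def invertible_det_nz by auto

lemma SL_subgroup_mult: "SL_subgroup G \<Longrightarrow> g \<in> G \<Longrightarrow> h \<in> G \<Longrightarrow> g ** h \<in> G"
  unfolding SL_subgroup_def by auto

lemma SL_subgroup_matrix_inv: "SL_subgroup G \<Longrightarrow> g \<in> G \<Longrightarrow> matrix_inv g \<in> G"
  unfolding SL_subgroup_def by auto

lemma SL_subgroup_mat_1: "SL_subgroup G \<Longrightarrow> mat 1 \<in> G"
  unfolding SL_subgroup_def by auto

lemma SL_subgroup_mpow: "SL_subgroup G \<Longrightarrow> g \<in> G \<Longrightarrow> mpow g k \<in> G"
  by (induction k) (auto simp: mpow_Suc SL_subgroup_mult SL_subgroup_mat_1)

lemma wlen_le_length: "is_word S ws g \<Longrightarrow> wlen S g \<le> length ws"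
  unfolding wlen_def by (rule Least_le) blast

lemma wlen_mat_1: "wlen S (mat 1) = 0"
  using wlen_le_length[of S "[]"] by (simp add: is_word_def)

lemma foldr_matrix_mult: "foldr (**) ws B = foldr (**) ws (mat 1) ** (B::'a::semiring_1^'n^'n)"
  by (induction ws) (auto simp: matrix_mul_assoc)

lemma is_word_append: "is_word S ws g \<Longrightarrow> is_word S vs h \<Longrightarrow> is_word S (ws @ vs) (g ** h)"
  unfolding is_word_def by (auto simp: foldr_matrix_mult[of ws "foldr (**) vs (mat 1)"])

lemma wdist_self_mult:
  assumes "invertible x"
  shows "wdist S x (x ** y) = real (wlen S y)"
  unfolding wdist_def by (metis matrix_inv_left[OF assms] matrix_mul_assoc matrix_mul_lid)

context
  fixes G S :: "(real^'n^'n) set"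
  assumes SL: "SL_subgroup G" and gen: "generates S G"
begin

lemma letters_in_group: "S \<union> matrix_inv ` S \<subseteq> G"
  using gen SL_subgroup_matrix_inv[OF SL] unfolding generates_def by auto

lemma matrix_inv_letter:
  assumes "s \<in> S \<union> matrix_inv ` S"
  shows "matrix_inv s \<in> S \<union> matrix_inv ` S"
proof -
  from assms consider "s \<in> S" | t where "t \<in> S" "s = matrix_inv t" by blast
  then show ?thesis
  proof cases
    case 2
    then have "matrix_inv s = t"
      using letters_in_group matrix_inv_matrix_inv SL_subgroup_invertible[OF SL] by blast
    with 2 show ?thesis by simp
  qed simp
qed

lemma shortest_word:
  assumes "g \<in> G"
  shows "\<exists>ws. length ws = wlen S g \<and> is_word S ws g"
proof -
  obtain ws where "is_word S ws g"
    using assms gen unfolding generates_def by blast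
  then have "\<exists>k ws. length ws = k \<and> is_word S ws g" by blast
  then show ?thesis unfolding wlen_def by (rule LeastI_ex)
qed

lemma wlen_mult_le:
  assumes "g \<in> G" "h \<in> G"
  shows "wlen S (g ** h) \<le> wlen S g + wlen S h"
proof -
  obtain ws where ws: "length ws = wlen S g" "is_word S ws g"
    using shortest_word[OF assms(1)] by blast
  obtain vs where vs: "length vs = wlen S h" "is_word S vs h"
    using shortest_word[OF assms(2)] by blast
  have "wlen S (g ** h) \<le> length (ws @ vs)"
    by (rule wlen_le_length[OF is_word_append[OF ws(2) vs(2)]])
  with ws vs show ?thesis by simp
qed

lemma wlen_mpow_le:
  assumes "g \<in> G"
  shows "wlen S (mpow g k) \<le> k * wlen S g"
proof (induction k)
  case (Suc k)
  have "wlen S (mpow g (Suc k)) \<le> wlen S g + wlen S (mpow g k)"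
    unfolding mpow_Suc by (rule wlen_mult_le[OF assms SL_subgroup_mpow[OF SL assms]])
  with Suc show ?case by simp
qed (simp add: wlen_mat_1)

lemma word_in_group: "set ws \<subseteq> S \<union> matrix_inv ` S \<Longrightarrow> foldr (**) ws (mat 1) \<in> G"
  by (induction ws) (use letters_in_group SL_subgroup_mult[OF SL] SL_subgroup_mat_1[OF SL] in auto)

lemma matrix_inv_word:
  assumes "set ws \<subseteq> S \<union> matrix_inv ` S"
  shows "matrix_inv (foldr (**) ws (mat 1)) = foldr (**) (rev (map matrix_inv ws)) (mat 1)"
  using assms
proof (induction ws)
  case (Cons s ws)
  have "s \<in> G" "foldr (**) ws (mat 1) \<in> G"
    using Cons.prems letters_in_group word_in_group by auto
  then have "matrix_inv (foldr (**) (s # ws) (mat 1)) = matrix_inv (foldr (**) ws (mat 1)) ** matrix_inv s"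
    by (simp add: matrix_inv_mult SL_subgroup_invertible[OF SL])
  also have "\<dots> = foldr (**) (rev (map matrix_inv ws)) (mat 1) ** matrix_inv s"
    using Cons by simp
  also have "\<dots> = foldr (**) (rev (map matrix_inv (s # ws))) (mat 1)"
    using foldr_matrix_mult[of "rev (map matrix_inv ws)" "matrix_inv s"] by simp
  finally show ?case .
qed (simp add: matrix_inv_mat_1)

lemma wlen_matrix_inv_le:
  assumes "g \<in> G"
  shows "wlen S (matrix_inv g) \<le> wlen S g"
proof -
  obtain ws where ws: "length ws = wlen S g" "is_word S ws g"
    using shortest_word[OF assms] by blast
  then have "set (rev (map matrix_inv ws)) \<subseteq> S \<union> matrix_inv ` S"
    using matrix_inv_letter unfolding is_word_def set_rev set_map by blast
  then have "is_word S (rev (map matrix_inv ws)) (matrix_inv g)"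
    using ws(2) matrix_inv_word unfolding is_word_def by auto
  from wlen_le_length[OF this] ws(1) show ?thesis by simp
qed

lemma wlen_matrix_inv:
  assumes "g \<in> G"
  shows "wlen S (matrix_inv g) = wlen S g"
  using wlen_matrix_inv_le[OF assms] wlen_matrix_inv_le[OF SL_subgroup_matrix_inv[OF SL assms]]
    matrix_inv_matrix_inv[OF SL_subgroup_invertible[OF SL assms]] by simp

lemma wdist_commute:
  assumes "x \<in> G" "y \<in> G"
  shows "wdist S x y = wdist S y x"
proof -
  have "matrix_inv (matrix_inv x ** y) = matrix_inv y ** x"
    using assms SL_subgroup_invertible[OF SL]
    by (simp add: matrix_inv_mult invertible_matrix_inv matrix_inv_matrix_inv)
  moreover have "matrix_inv x ** y \<in> G"
    using assms SL_subgroup_matrix_inv[OF SL] SL_subgroup_mult[OF SL] by blast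
  ultimately show ?thesis unfolding wdist_def by (metis wlen_matrix_inv)
qed

lemma wdist_triangle:
  assumes "x \<in> G" "y \<in> G" "z \<in> G"
  shows "wdist S x z \<le> wdist S x y + wdist S y z"
proof -
  have "(matrix_inv x ** y) ** (matrix_inv y ** z) = matrix_inv x ** (y ** matrix_inv y) ** z"
    by (simp add: matrix_mul_assoc)
  then have "matrix_inv x ** z = (matrix_inv x ** y) ** (matrix_inv y ** z)"
    using matrix_inv_right[OF SL_subgroup_invertible[OF SL assms(2)]] by simp
  moreover have "matrix_inv x ** y \<in> G" "matrix_inv y ** z \<in> G"
    using assms SL_subgroup_matrix_inv[OF SL] SL_subgroup_mult[OF SL] by blast+
  ultimately show ?thesis
    unfolding wdist_def using wlen_mult_le by (metis of_nat_add of_nat_le_iff)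
qed

lemma gprod_ge_perturbed:
  assumes "w \<in> G" "x \<in> G" "y \<in> G" "x' \<in> G" "y' \<in> G"
  shows "gprod S w x y \<ge> gprod S w x' y' - wdist S x x' - wdist S y y'"
proof -
  have "wdist S x' w \<le> wdist S x' x + wdist S x w"
    and "wdist S y' w \<le> wdist S y' y + wdist S y w"
    and "wdist S x y \<le> wdist S x x' + wdist S x' y"
    and "wdist S x' y \<le> wdist S x' y' + wdist S y' y"
    using assms by (simp_all add: wdist_triangle)
  moreover note wdist_commute[OF assms(4,2)] wdist_commute[OF assms(5,3)]
  ultimately show ?thesis unfolding gprod_def by (simp add: field_simps)
qed

lemma wdist_mpow_mod_le:
  assumes "g \<in> G" "N \<ge> 1"
  shows "wdist S (mpow g m) (mpow g (m div N * N)) \<le> real (N * wlen S g)"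
proof -
  have mpow_in: "mpow g k \<in> G" for k by (rule SL_subgroup_mpow[OF SL assms(1)])
  have "mpow g m = mpow g (m div N * N) ** mpow g (m mod N)"
    by (simp add: mpow_add[symmetric])
  then have "wdist S (mpow g (m div N * N)) (mpow g m) = real (wlen S (mpow g (m mod N)))"
    by (simp add: wdist_self_mult SL_subgroup_invertible[OF SL mpow_in])
  also have "\<dots> \<le> real (m mod N * wlen S g)"
    using wlen_mpow_le[OF assms(1)] of_nat_le_iff by blast
  also have "\<dots> \<le> real (N * wlen S g)"
    unfolding of_nat_le_iff using \<open>N \<ge> 1\<close>
    by (intro mult_le_mono1 less_imp_le_nat mod_less_divisor) simp
  finally show ?thesis by (simp add: wdist_commute[OF mpow_in mpow_in])
qed

lemma mpow_progression_gprod_bound: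
  assumes g: "g \<in> G" and "\<delta> \<ge> 0"
    and hyp: "\<And>x y z w. x \<in> G \<Longrightarrow> y \<in> G \<Longrightarrow> z \<in> G \<Longrightarrow> w \<in> G \<Longrightarrow>
      gprod S w x z \<ge> min (gprod S w x y) (gprod S w y z) - \<delta>"
    and gap: "real (wlen S (mpow g (2 * N))) - real (wlen S (mpow g N)) > 4 * \<delta>"
  shows "gprod S (mat 1) (mpow g (q * N)) (mpow g (q' * N)) \<ge> real (wlen S (mpow g (min q q' * N)))
    - (2 * real (wlen S (mpow g N)) - real (wlen S (mpow g (2 * N)))) / 2 - 2 * \<delta>"
proof -
  define P where "P i = mpow g (i * N)" for i
  define h where "h k = real (wlen S (mpow g (k * N)))" for k
  have P_in: "P i \<in> G" for i
    unfolding P_def by (rule SL_subgroup_mpow[OF SL g])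
  have dist: "wdist S (P i) (P j) = h (j - i)" if "i \<le> j" for i j
  proof -
    have "P j = P i ** mpow g ((j - i) * N)"
      unfolding P_def mpow_add[symmetric] using that by (simp add: algebra_simps)
    then show ?thesis
      unfolding h_def by (simp add: wdist_self_mult SL_subgroup_invertible[OF SL P_in])
  qed
  have "mpow g (2 * N) = mpow g N ** mpow g N"
    by (simp add: mpow_add[symmetric] mult_2)
  then have "h 2 \<le> 2 * h 1"
    using wlen_mult_le[OF SL_subgroup_mpow[OF SL g] SL_subgroup_mpow[OF SL g], of N N]
    unfolding h_def by simp
  moreover have "h 2 - h 1 > 4 * \<delta>" "h 0 = 0"
    using gap unfolding h_def by (simp_all add: wlen_mat_1)
  moreover have "wdist S (P i) (P j) = wdist S (P j) (P i)" for i j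
    by (rule wdist_commute[OF P_in P_in])
  ultimately have "gprod S (P 0) (P q) (P q') \<ge> h (min q q') - (2 * h 1 - h 2) / 2 - 2 * \<delta>"
    using gromov_product_progression_bound[where D = "\<lambda>i j. wdist S (P i) (P j)",
        OF _ dist hyp[OF P_in P_in P_in P_in, unfolded gprod_def] _ \<open>\<delta> \<ge> 0\<close>]
    unfolding gprod_def by blast
  then show ?thesis unfolding P_def h_def by simp
qed

end

section \<open>Powers with an expanding eigenvalue converge at infinity\<close>

lemma norm_word_product_le:
  fixes M :: real and x :: "real^'n"
  assumes "set ws \<subseteq> X" "\<And>s x. s \<in> X \<Longrightarrow> norm (s *v x) \<le> M * norm x" "0 \<le> M"
  shows "norm (foldr (**) ws (mat 1) *v x) \<le> M ^ length ws * norm x"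
  using assms(1)
proof (induction ws arbitrary: x)
  case (Cons s ws)
  have "norm (foldr (**) (s # ws) (mat 1) *v x) = norm (s *v (foldr (**) ws (mat 1) *v x))"
    by (simp add: matrix_vector_mul_assoc)
  also have "\<dots> \<le> M * norm (foldr (**) ws (mat 1) *v x)"
    using assms(2) Cons.prems by simp
  also have "\<dots> \<le> M * (M ^ length ws * norm x)"
    using Cons assms(3) by (simp add: mult_left_mono)
  finally show ?case by simp
qed simp

lemma wlen_mpow_linear_lower_bound:
  fixes G S :: "(real^'n^'n) set"
  assumes SL: "SL_subgroup G" and gen: "generates S G" and "finite S"
    and g: "g \<in> G" and "w \<noteq> 0" "g *v w = \<mu> *\<^sub>R w" and "\<bar>\<mu>\<bar> > 1"
  shows "\<exists>a>0. \<forall>n. a * real n \<le> real (wlen S (mpow g n))"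
proof -
  define X where "X = S \<union> matrix_inv ` S"
  define M where "M = 2 + (\<Sum>s\<in>X. onorm ((*v) s))"
  have "finite X" using \<open>finite S\<close> unfolding X_def by simp
  have onorm_nonneg: "0 \<le> onorm ((*v) s)" for s :: "real^'n^'n"
    by (rule onorm_pos_le) simp
  then have "M \<ge> 2" unfolding M_def by (simp add: sum_nonneg)
  have letter_bound: "norm (s *v x) \<le> M * norm x" if "s \<in> X" for s x
  proof -
    have "onorm ((*v) s) \<le> (\<Sum>s\<in>X. onorm ((*v) s))"
      by (rule member_le_sum) (use that \<open>finite X\<close> onorm_nonneg in auto)
    then have "onorm ((*v) s) \<le> M" unfolding M_def by simp
    moreover have "norm (s *v x) \<le> onorm ((*v) s) * norm x" by (rule onorm) simp
    ultimately show ?thesis by (meson mult_right_mono norm_ge_zero order_trans)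
  qed
  \<comment> \<open>A word of length \<open>k\<close> stretches vectors by at most \<open>M^k\<close>, while \<open>g^n\<close> stretches \<open>w\<close> by \<open>|\<mu>|^n\<close>.\<close>
  have "ln \<bar>\<mu>\<bar> * real n \<le> ln M * real (wlen S (mpow g n))" for n
  proof -
    obtain ws where ws: "length ws = wlen S (mpow g n)" "is_word S ws (mpow g n)"
      using shortest_word[OF SL gen SL_subgroup_mpow[OF SL g]] by blast
    have "norm (mpow g n *v w) \<le> M ^ length ws * norm w"
      using ws(2) norm_word_product_le[of ws X M w] letter_bound \<open>M \<ge> 2\<close>
      unfolding is_word_def X_def by auto
    then have "\<bar>\<mu>\<bar> ^ n \<le> M ^ length ws"
      using mpow_eigenvector[OF assms(6)] \<open>w \<noteq> 0\<close> by (simp add: power_abs)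
    then have "ln (\<bar>\<mu>\<bar> ^ n) \<le> ln (M ^ length ws)"
      using \<open>\<bar>\<mu>\<bar> > 1\<close> \<open>M \<ge> 2\<close> by simp
    then show ?thesis using \<open>\<bar>\<mu>\<bar> > 1\<close> \<open>M \<ge> 2\<close> ws(1) by (simp add: ln_realpow mult.commute)
  qed
  then have "ln \<bar>\<mu>\<bar> / ln M * real n \<le> real (wlen S (mpow g n))" for n
    using \<open>M \<ge> 2\<close> by (simp add: field_simps)
  moreover have "ln \<bar>\<mu>\<bar> / ln M > 0" using \<open>\<bar>\<mu>\<bar> > 1\<close> \<open>M \<ge> 2\<close> by simp
  ultimately show ?thesis by blast
qed

lemma mpow_multiples_gprod_lower_bound:
  assumes SL: "SL_subgroup G" and gen: "generates S G" and hyperbolic: "gromov_hyperbolic G S"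
    and g: "g \<in> G" and "a > 0" and growth: "\<And>n. a * real n \<le> real (wlen S (mpow g n))"
  obtains N B where "N \<ge> 1"
    "\<And>q q'. gprod S (mat 1) (mpow g (q * N)) (mpow g (q' * N)) \<ge> a * real (min q q') - B"
proof -
  obtain \<delta> where "\<delta> \<ge> 0" and hyp: "\<And>x y z w. x \<in> G \<Longrightarrow> y \<in> G \<Longrightarrow> z \<in> G \<Longrightarrow> w \<in> G \<Longrightarrow>
      gprod S w x z \<ge> min (gprod S w x y) (gprod S w y z) - \<delta>"
    using hyperbolic unfolding gromov_hyperbolic_def by metis
  obtain N where "N \<ge> 1"
    and gap: "real (wlen S (mpow g (2 * N))) - real (wlen S (mpow g N)) > 4 * \<delta>"
    using linear_growth_doubling_gap[OF \<open>a > 0\<close> growth] by blast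
  have linear: "a * real k \<le> real (wlen S (mpow g (k * N)))" for k
  proof -
    have "real k \<le> real (k * N)"
      using \<open>N \<ge> 1\<close> by (metis of_nat_le_iff mult_le_mono2 nat_mult_1_right)
    then have "a * real k \<le> a * real (k * N)"
      using \<open>a > 0\<close> by (simp add: mult_left_mono)
    also have "\<dots> \<le> real (wlen S (mpow g (k * N)))" by (rule growth)
    finally show ?thesis .
  qed
  define B where "B = (2 * real (wlen S (mpow g N)) - real (wlen S (mpow g (2 * N)))) / 2 + 2 * \<delta>"
  have "gprod S (mat 1) (mpow g (q * N)) (mpow g (q' * N)) \<ge> a * real (min q q') - B" for q q'
    using mpow_progression_gprod_bound[OF SL gen g \<open>\<delta> \<ge> 0\<close> hyp gap, of q q'] linear[of "min q q'"]
    unfolding B_def by linarith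
  with \<open>N \<ge> 1\<close> show ?thesis by (rule that)
qed

lemma mpow_conv_inf:
  assumes SL: "SL_subgroup G" and gen: "generates S G" and hyperbolic: "gromov_hyperbolic G S"
    and g: "g \<in> G" and "a > 0" and growth: "\<And>n. a * real n \<le> real (wlen S (mpow g n))"
  shows "conv_inf G S (mpow g)"
proof -
  obtain N B where "N \<ge> 1" and multiples:
    "\<And>q q'. gprod S (mat 1) (mpow g (q * N)) (mpow g (q' * N)) \<ge> a * real (min q q') - B"
    using mpow_multiples_gprod_lower_bound[OF SL gen hyperbolic g \<open>a > 0\<close> growth] by blast
  have mpow_in: "mpow g k \<in> G" for k by (rule SL_subgroup_mpow[OF SL g])
  define E where "E = real (N * wlen S g)"
  note near = wdist_mpow_mod_le[OF SL gen g \<open>N \<ge> 1\<close>, folded E_def]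
  show ?thesis
    unfolding conv_inf_def
  proof (intro conjI allI)
    fix K :: real
    obtain Q :: nat where "(K + B + 2 * E) / a \<le> real Q" using real_arch_simple by blast
    then have Q: "K + B + 2 * E \<le> a * real Q" using \<open>a > 0\<close> by (simp add: field_simps)
    have "K \<le> gprod S (mat 1) (mpow g m) (mpow g k)" if "Q * N \<le> m" "Q * N \<le> k" for m k
    proof -
      have "Q \<le> m div N" "Q \<le> k div N"
        using div_le_mono[OF that(1), of N] div_le_mono[OF that(2), of N] \<open>N \<ge> 1\<close> by simp_all
      then have "a * real Q \<le> a * real (min (m div N) (k div N))"
        using \<open>a > 0\<close> by simp
      moreover have "gprod S (mat 1) (mpow g m) (mpow g k) \<ge> gprod S (mat 1) (mpow g (m div N * N))
          (mpow g (k div N * N)) - wdist S (mpow g m) (mpow g (m div N * N))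
          - wdist S (mpow g k) (mpow g (k div N * N))"
        by (rule gprod_ge_perturbed[OF SL gen SL_subgroup_mat_1[OF SL] mpow_in mpow_in mpow_in mpow_in])
      ultimately show ?thesis
        using multiples[of "m div N" "k div N"] near[of m] near[of k] Q by linarith
    qed
    then show "\<exists>N. \<forall>m\<ge>N. \<forall>k\<ge>N. K \<le> gprod S (mat 1) (mpow g m) (mpow g k)" by blast
  qed (rule mpow_in)
qed

section \<open>Eigenlines given by the limit maps\<close>

lemma proj_eq_if_in_span: "u \<noteq> 0 \<Longrightarrow> u \<in> span {w} \<Longrightarrow> proj_eq u w"
  unfolding proj_eq_def span_singleton by auto

lemma act_eq_rescaling:
  fixes g :: "real^'n^'n"
  assumes "invertible g" "\<alpha> \<bullet> v \<noteq> 0" "act_eq g v \<alpha> (t *\<^sub>R v) (inverse t *\<^sub>R \<alpha>)"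
  obtains c where "\<bar>c\<bar> = 1" "g *v v = (c * t) *\<^sub>R v"
    "\<alpha> v* matrix_inv g = (c * inverse t) *\<^sub>R \<alpha>" "matrix_inv g *v v = (c * inverse t) *\<^sub>R v"
proof -
  obtain c where gv: "g *v v = (c * t) *\<^sub>R v" and \<alpha>g: "\<alpha> v* matrix_inv g = (c * inverse t) *\<^sub>R \<alpha>"
    using assms(3) unfolding act_eq_def by auto
  have "\<alpha> \<bullet> v = (\<alpha> v* matrix_inv g) \<bullet> (g *v v)"
    by (simp add: dot_lmul_matrix matrix_vector_mul_assoc matrix_inv_left[OF assms(1)])
  also have "\<dots> = (c * inverse t) * (c * t) * (\<alpha> \<bullet> v)"
    by (simp add: gv \<alpha>g)
  finally have cct: "c * c * (inverse t * t) = 1"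
    using assms(2) by (simp add: algebra_simps)
  then have "t \<noteq> 0" by auto
  with cct have "c = 1 \<or> c = -1" by (simp add: square_eq_1_iff)
  then have "\<bar>c\<bar> = 1" and "inverse (c * t) = c * inverse t" by auto
  with gv \<alpha>g show ?thesis
    using that matrix_inv_eigenvector[OF assms(1) gv] by metis
qed

lemmas limit_maps_eigen_data =
  limit_maps_def[THEN iffD1, THEN conjunct2, THEN conjunct2, THEN conjunct2, rule_format]

lemma limit_maps_attracting_eigenvector:
  assumes "limit_maps G S \<xi> \<xi>s" "g \<in> G" "infinite_order g"
  obtains \<mu> where "\<bar>\<mu>\<bar> > 1" "\<xi> (attr_pt G S g) \<noteq> 0"
    "g *v \<xi> (attr_pt G S g) = \<mu> *\<^sub>R \<xi> (attr_pt G S g)"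
proof -
  obtain \<mu> where "\<bar>\<mu>\<bar> = exp (lam 1 g)" "lam 1 g > 0"
    and root: "count (proots (cpoly g)) (complex_of_real \<mu>) = 1"
    and eigenspace: "{w. g *v w = \<mu> *\<^sub>R w} = span {\<xi> (attr_pt G S g)}"
    using limit_maps_eigen_data[OF assms] by blast
  then have "\<bar>\<mu>\<bar> > 1" by simp
  have "poly (cpoly g) (complex_of_real \<mu>) = 0"
    using root by (metis count_proots order_root zero_neq_one)
  then obtain w where "w \<noteq> 0" "w \<in> span {\<xi> (attr_pt G S g)}"
    using cpoly_real_root_iff_eigenvector eigenspace by blast
  then have "\<xi> (attr_pt G S g) \<noteq> 0" by auto
  moreover have "g *v \<xi> (attr_pt G S g) = \<mu> *\<^sub>R \<xi> (attr_pt G S g)"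
    using eigenspace span_base[of "\<xi> (attr_pt G S g)"] by blast
  ultimately show ?thesis using that \<open>\<bar>\<mu>\<bar> > 1\<close> by blast
qed

lemma limit_maps_top_eigenvector:
  assumes "limit_maps G S \<xi> \<xi>s" "g \<in> G" "infinite_order g"
    and "v \<noteq> 0" "g *v v = c *\<^sub>R v" "\<bar>c\<bar> = exp (lam 1 g)"
  shows "proj_eq v (\<xi> (attr_pt G S g))"
proof -
  obtain \<mu> where root: "count (proots (cpoly g)) (complex_of_real \<mu>) = 1"
    and top: "\<forall>z. z \<in># proots (cpoly g) \<and> cmod z = exp (lam 1 g) \<longrightarrow> z = complex_of_real \<mu>"
    and eigenspace: "{w. g *v w = \<mu> *\<^sub>R w} = span {\<xi> (attr_pt G S g)}"
    using limit_maps_eigen_data[OF assms(1-3)] by blast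
  have "poly (cpoly g) (complex_of_real c) = 0"
    using cpoly_real_root_iff_eigenvector assms(4,5) by blast
  moreover have "cpoly g \<noteq> 0" using root by auto
  ultimately have "complex_of_real c = complex_of_real \<mu>"
    using top[rule_format, of "complex_of_real c"] assms(6) by simp
  then have "v \<in> span {\<xi> (attr_pt G S g)}"
    using eigenspace assms(5) by auto
  with assms(4) show ?thesis by (rule proj_eq_if_in_span)
qed

lemma limit_maps_attracting_line_annihilated:
  assumes "limit_maps G S \<xi> \<xi>s" "g \<in> G" "infinite_order g"
    and "a v* g = \<kappa> *\<^sub>R a" "\<bar>\<kappa>\<bar> \<le> 1"
  shows "a \<bullet> \<xi> (attr_pt G S g) = 0"
proof (rule ccontr)
  assume "a \<bullet> \<xi> (attr_pt G S g) \<noteq> 0"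
  obtain \<mu> where "\<bar>\<mu>\<bar> > 1" "g *v \<xi> (attr_pt G S g) = \<mu> *\<^sub>R \<xi> (attr_pt G S g)"
    using limit_maps_attracting_eigenvector[OF assms(1-3)] by blast
  with eigenvector_pairing[OF assms(4)] \<open>a \<bullet> \<xi> (attr_pt G S g) \<noteq> 0\<close> have "\<kappa> = \<mu>" by blast
  with \<open>\<bar>\<mu>\<bar> > 1\<close> \<open>\<bar>\<kappa>\<bar> \<le> 1\<close> show False by simp
qed

lemma limit_maps_repelling_dual_eigenvalue:
  assumes "limit_maps G S \<xi> \<xi>s" "g \<in> G" "infinite_order g"
    and "matrix_inv g *v v = \<kappa> *\<^sub>R v" "\<xi>s (rep_pt G S g) \<bullet> v \<noteq> 0"
  shows "\<bar>\<kappa>\<bar> = exp (- lam 1 g)"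
    and "{a. a v* matrix_inv g = \<kappa> *\<^sub>R a} = span {\<xi>s (rep_pt G S g)}"
proof -
  obtain \<nu> where "\<bar>\<nu>\<bar> = exp (- lam 1 g)"
    and eigenspace: "{a. a v* matrix_inv g = \<nu> *\<^sub>R a} = span {\<xi>s (rep_pt G S g)}"
    using limit_maps_eigen_data[OF assms(1-3)] by blast
  moreover have "\<nu> = \<kappa>"
    using eigenvector_pairing[OF _ assms(4,5)] eigenspace span_base[of "\<xi>s (rep_pt G S g)"] by blast
  ultimately show "\<bar>\<kappa>\<bar> = exp (- lam 1 g)"
    and "{a. a v* matrix_inv g = \<kappa> *\<^sub>R a} = span {\<xi>s (rep_pt G S g)}" by simp_all
qed

lemma rep_pt_eq_attr_pt_matrix_inv: "rep_pt G S g = attr_pt G S (matrix_inv g)"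
  unfolding rep_pt_def attr_pt_def ..

lemma attr_pt_in_bdry:
  assumes "proj_anosov G S" "limit_maps G S \<xi> \<xi>s" "g \<in> G" "infinite_order g"
  shows "attr_pt G S g \<in> bdry G S"
proof -
  have SL: "SL_subgroup G" and gen: "generates S G"
    and "finite S" and hyperbolic: "gromov_hyperbolic G S"
    using assms(1) unfolding proj_anosov_def fg_hyperbolic_def by auto
  obtain \<mu> where "\<bar>\<mu>\<bar> > 1" "\<xi> (attr_pt G S g) \<noteq> 0"
    "g *v \<xi> (attr_pt G S g) = \<mu> *\<^sub>R \<xi> (attr_pt G S g)"
    using limit_maps_attracting_eigenvector[OF assms(2-4)] by blast
  then obtain a where "a > 0" "\<And>n. a * real n \<le> real (wlen S (mpow g n))"
    using wlen_mpow_linear_lower_bound[OF SL gen \<open>finite S\<close> assms(3)] by blast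
  then have "conv_inf G S (mpow g)"
    by (rule mpow_conv_inf[OF SL gen hyperbolic assms(3)])
  then show ?thesis unfolding attr_pt_def bdry_def by blast
qed

lemma torsion_free_infinite_order:
  assumes "SL_subgroup G" "torsion_free G" "g \<in> G" "g \<noteq> mat 1"
  shows "infinite_order g" "infinite_order (matrix_inv g)"
proof -
  have "matrix_inv g \<noteq> mat 1"
    using assms(4) matrix_inv_matrix_inv[OF SL_subgroup_invertible[OF assms(1,3)]] matrix_inv_mat_1
    by metis
  then show "infinite_order g" "infinite_order (matrix_inv g)"
    using assms SL_subgroup_matrix_inv unfolding torsion_free_def by auto
qed

theorem lemma3p5:
  fixes G S :: "(real^'n^'n) set"
    and \<xi> \<xi>s :: "(nat \<Rightarrow> real^'n^'n) set \<Rightarrow> real^'n"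
    and v \<alpha> :: "real^'n" and \<gamma> :: "real^'n^'n" and T :: real
  assumes "CARD('n) > 1"
    and "proj_anosov G S"
    and "torsion_free G"
    and "limit_maps G S \<xi> \<xi>s"
    and "Mtilde G S \<xi> \<xi>s v \<alpha>"
    and "\<gamma> \<in> G" and "\<gamma> \<noteq> mat 1"
    and "T \<ge> 0"
    and "act_eq \<gamma> v \<alpha> (exp T *\<^sub>R v) (exp (- T) *\<^sub>R \<alpha>)"
  shows "proj_eq v (\<xi> (attr_pt G S \<gamma>)) \<and> proj_eq \<alpha> (\<xi>s (rep_pt G S \<gamma>)) \<and> T = lam 1 \<gamma>"
proof -
  have SL: "SL_subgroup G" using assms(2) unfolding proj_anosov_def by simp
  have "invertible \<gamma>" "matrix_inv \<gamma> \<in> G"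
    using SL assms(6) by (simp_all add: SL_subgroup_invertible SL_subgroup_matrix_inv)
  note order = torsion_free_infinite_order[OF SL assms(3,6,7)]
  have "\<alpha> \<bullet> v > 0" and transverse: "\<forall>x\<in>bdry G S. \<xi>s x \<bullet> v \<noteq> 0 \<or> \<alpha> \<bullet> \<xi> x \<noteq> 0"
    using assms(5) unfolding Mtilde_def by auto
  obtain c where "\<bar>c\<bar> = 1" and "\<gamma> *v v = (c * exp T) *\<^sub>R v"
    and \<alpha>_eigen: "\<alpha> v* matrix_inv \<gamma> = (c * exp (- T)) *\<^sub>R \<alpha>"
    and v_eigen: "matrix_inv \<gamma> *v v = (c * exp (- T)) *\<^sub>R v"
    using act_eq_rescaling[OF \<open>invertible \<gamma>\<close> _ assms(9)[unfolded exp_minus]] \<open>\<alpha> \<bullet> v > 0\<close>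
    unfolding exp_minus by auto
  have "\<bar>c * exp (- T)\<bar> \<le> 1" using \<open>\<bar>c\<bar> = 1\<close> \<open>T \<ge> 0\<close> by (simp add: abs_mult)
  then have "\<alpha> \<bullet> \<xi> (rep_pt G S \<gamma>) = 0"
    unfolding rep_pt_eq_attr_pt_matrix_inv
    by (rule limit_maps_attracting_line_annihilated[OF assms(4) \<open>matrix_inv \<gamma> \<in> G\<close> order(2) \<alpha>_eigen])
  moreover have "rep_pt G S \<gamma> \<in> bdry G S"
    unfolding rep_pt_eq_attr_pt_matrix_inv
    by (rule attr_pt_in_bdry[OF assms(2,4) \<open>matrix_inv \<gamma> \<in> G\<close> order(2)])
  ultimately have "\<xi>s (rep_pt G S \<gamma>) \<bullet> v \<noteq> 0" using transverse by auto
  note dual = limit_maps_repelling_dual_eigenvalue[OF assms(4,6) order(1) v_eigen this]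
  from dual(1) have "T = lam 1 \<gamma>" using \<open>\<bar>c\<bar> = 1\<close> by (simp add: abs_mult)
  moreover have "proj_eq \<alpha> (\<xi>s (rep_pt G S \<gamma>))"
    using \<alpha>_eigen dual(2) \<open>\<alpha> \<bullet> v > 0\<close> by (intro proj_eq_if_in_span) auto
  moreover have "proj_eq v (\<xi> (attr_pt G S \<gamma>))"
    using limit_maps_top_eigenvector[OF assms(4,6) order(1) _ \<open>\<gamma> *v v = (c * exp T) *\<^sub>R v\<close>]
      \<open>\<alpha> \<bullet> v > 0\<close> \<open>\<bar>c\<bar> = 1\<close> \<open>T = lam 1 \<gamma>\<close> by (force simp: abs_mult)
  ultimately show ?thesis by blast
qed

end
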